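(* Let $p$ be an odd prime, $e\ge 1$ an integer, $c\in\mathbb{Z}$ fixed, and let $g\in\mathbb{Z}$ be fixed with $p\nmid g$. Let $m$ be the multiplicative order of $g$ modulo $p$. Then there are exactly $m$ solutions $x\in\{1,2,\ldots,p^e m\}$ to the congruence $$g^{x-1+c}\equiv x\pmod{p^e}.$$ These solutions are all distinct modulo $m$ and relatively prime to $p$.
   Context: Powers of $g$ with negative exponents are understood in the unit group $(\mathbb{Z}/p^e\mathbb{Z})^\times$. *)

theory Defs
  imports "HOL-Number_Theory.Number_Theory"
begin

text \<open>
  The power of the residue class of \<open>g\<close> in the unit group modulo \<open>n\<close>, for an arbitrary integer
  exponent, represented in \<open>{0..<n}\<close>. Only meaningful for \<open>n > 1\<close> and \<open>g\<close> coprime to \<open>n\<close>.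
\<close>

definition unit_power :: "int \<Rightarrow> int \<Rightarrow> int \<Rightarrow> int" where
  "unit_power n g k = (g mod n) [^]\<^bsub>units_of (residue_ring n)\<^esub> k"

lemma unit_power_of_nat:
  assumes "n > 1"
  shows "unit_power n g (int k) = g ^ k mod n"
proof -
  have "unit_power n g (int k) = (g mod n) [^]\<^bsub>units_of (residue_ring n)\<^esub> k"
    by (simp add: unit_power_def int_pow_int)
  also have "\<dots> = g ^ k mod n"
    using assms by (induction k) (simp_all add: units_of_def residue_ring_def mod_simps mult.commute)
  finally show ?thesis .
qed

lemma unit_power_minus_of_nat:
  assumes "n > 1" and "coprime g n"
  shows "[unit_power n g (- int k) * g ^ k = 1] (mod n)"
proof -
  interpret residues n "residue_ring n"
    by unfold_locales (use assms in simp_all)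
  interpret U: group "units_of (residue_ring n)"
    by (rule units_group)
  have g: "g mod n \<in> carrier (units_of (residue_ring n))"
    using assms by (simp add: units_of_def mod_in_res_units)
  have "unit_power n g (- int k) \<otimes>\<^bsub>units_of (residue_ring n)\<^esub> unit_power n g (int k)
      = \<one>\<^bsub>units_of (residue_ring n)\<^esub>"
    unfolding unit_power_def by (subst U.int_pow_mult[symmetric]) (use g in simp_all)
  then have "(unit_power n g (- int k) * (g ^ k mod n)) mod n = 1"
    using assms by (simp add: unit_power_of_nat units_of_def residue_ring_def)
  then show ?thesis
    using assms by (simp add: cong_def mod_simps)
qed

end

theory Submission
  imports Defs
begin

text \<open>
  Put \<open>f x = g^(x - 1 + c)\<close>. Since \<open>g^m \<equiv> 1\<close> modulo \<open>p\<close>, raising to the \<open>p\<close>-th power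
  repeatedly gives \<open>g^(m p^k) \<equiv> 1\<close> modulo \<open>p^(k+1)\<close>, so \<open>x \<equiv> y\<close> modulo \<open>m p^k\<close> implies
  \<open>f x \<equiv> f y\<close> modulo \<open>p^(k+1)\<close>: on a residue class modulo \<open>m\<close> the map \<open>f\<close> is a \<open>p\<close>-adic
  contraction. As \<open>m\<close> divides \<open>p - 1\<close>, it is coprime to \<open>p\<close>, and the Chinese remainder theorem
  allows one to iterate \<open>f\<close> without leaving the residue class. So each of the \<open>m\<close> classes contains
  exactly one fixed point modulo \<open>p^e\<close> among \<open>1, \<dots>, p^e m\<close>. A fixed point is congruent to a power
  of \<open>g\<close>, hence a unit.
\<close>

section \<open>Powers congruent to 1 modulo powers of \<open>p\<close>\<close>

text \<open>\<open>a ^ p - 1\<close> is \<open>a - 1\<close> times a geometric sum of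
  \<open>p\<close> terms, each congruent to 1 modulo \<open>p\<close>; the sum supplies the extra
  factor \<open>p\<close>.\<close>

lemma cong_1_power_prime_lift:
  fixes a :: int and p :: nat
  assumes "[a = 1] (mod int p ^ Suc k)"
  shows "[a ^ p = 1] (mod int p ^ Suc (Suc k))"
proof -
  have "[a = 1] (mod int p)"
    using assms by (rule cong_dvd_modulus) simp
  then have "[(\<Sum>i<p. a ^ i) = (\<Sum>i<p. 1 ^ i)] (mod int p)"
    by (intro cong_sum cong_pow)
  then have "int p dvd (\<Sum>i<p. a ^ i)"
    by (simp add: cong_dvd_iff)
  then have "int p ^ Suc k * int p dvd (a - 1) * (\<Sum>i<p. a ^ i)"
    using assms by (intro mult_dvd_mono) (simp_all add: cong_iff_dvd_diff)
  then show ?thesis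
    by (simp add: cong_iff_dvd_diff power_diff_1_eq mult.commute)
qed

lemma cong_1_power_mult_prime_power:
  fixes a :: int and p m :: nat
  assumes "[a ^ m = 1] (mod int p)"
  shows "[a ^ (m * p ^ k) = 1] (mod int p ^ Suc k)"
proof (induction k)
  case 0
  then show ?case using assms by simp
next
  case (Suc k)
  from cong_1_power_prime_lift[OF Suc.IH] show ?case
    by (simp add: power_mult[symmetric] mult.assoc mult.commute[of p])
qed

text \<open>Carries the order over to natural numbers, where it is compared with the totient of
  \<open>p\<close>.\<close>

lemma ord_int_eq_ord_nat:
  fixes a :: int and n :: nat
  assumes "n > 0"
  shows "Pocklington.ord (int n) a = Pocklington.ord n (nat (a mod int n))"
proof -
  define b where "b = nat (a mod int n)"
  have b: "int b = a mod int n"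
    using assms by (simp add: b_def)
  have "[a ^ d = 1] (mod int n) \<longleftrightarrow> [b ^ d = 1] (mod n)" for d
  proof -
    have "[b ^ d = 1] (mod n) \<longleftrightarrow> [int b ^ d = 1] (mod int n)"
      by (simp flip: cong_int_iff)
    also have "\<dots> \<longleftrightarrow> [a ^ d = 1] (mod int n)"
      by (simp add: b cong_def power_mod)
    finally show ?thesis ..
  qed
  moreover have "coprime (int n) a \<longleftrightarrow> coprime n b"
  proof -
    have "coprime n b \<longleftrightarrow> coprime (int n) (int b)"
      by simp
    also have "\<dots> \<longleftrightarrow> coprime (int n) a"
      using assms by (simp add: b coprime_commute)
    finally show ?thesis ..
  qed
  ultimately show ?thesis
    by (simp add: ord_def b_def)
qed

section \<open>Unit powers with integer exponents\<close>

lemma unit_power_add_of_nat: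
  assumes "n > 1" and "coprime g n"
  shows "[unit_power n g (k + int j) = unit_power n g k * g ^ j] (mod n)"
proof -
  interpret residues n "residue_ring n"
    by unfold_locales (use assms in simp_all)
  interpret U: group "units_of (residue_ring n)"
    by (rule units_group)
  have g: "g mod n \<in> carrier (units_of (residue_ring n))"
    using assms by (simp add: units_of_def mod_in_res_units)
  have "unit_power n g (k + int j)
      = unit_power n g k \<otimes>\<^bsub>units_of (residue_ring n)\<^esub> unit_power n g (int j)"
    unfolding unit_power_def by (rule U.int_pow_mult[OF g])
  also have "\<dots> = unit_power n g k * (g ^ j mod n) mod n"
    using assms by (simp add: unit_power_of_nat units_of_def residue_ring_def)
  finally show ?thesis
    by (simp add: cong_def mod_simps)
qed

lemma coprime_unit_power:
  assumes "n > 1" and "coprime g n"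
  shows "coprime (unit_power n g k) n"
proof -
  \<comment> \<open>Multiplying by \<open>g ^ nat \<bar>k\<bar>\<close> makes the exponent
    nonnegative, so the product is an ordinary power of \<open>g\<close>, hence coprime to
    \<open>n\<close>, and so are its factors.\<close>
  define i where "i = nat (k + \<bar>k\<bar>)"
  have i: "k + int (nat \<bar>k\<bar>) = int i"
    by (simp add: i_def)
  have "coprime (g ^ i) n"
    using assms by simp
  moreover have "[unit_power n g k * g ^ nat \<bar>k\<bar> = g ^ i] (mod n)"
    using unit_power_add_of_nat[OF assms, of k "nat \<bar>k\<bar>"] assms unfolding i
    by (simp add: unit_power_of_nat cong_def)
  ultimately have "coprime (unit_power n g k * g ^ nat \<bar>k\<bar>) n"
    using cong_imp_coprime cong_sym by blast
  then show ?thesis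
    by simp
qed

text \<open>The divisor \<open>d\<close> is kept apart from \<open>n\<close> because powers are
  formed modulo \<open>p ^ e\<close> but compared modulo lower powers of \<open>p\<close>.\<close>

lemma unit_power_cong:
  fixes n g d :: int and l :: nat
  assumes n: "n > 1" and g: "coprime g n" and d: "d dvd n" and l: "[g ^ l = 1] (mod d)"
    and ab: "[a = b] (mod int l)"
  shows "[unit_power n g a = unit_power n g b] (mod d)"
  using ab
proof (induction a b rule: linorder_wlog)
  case (le a b)
  then have "int l dvd b - a"
    by (simp add: cong_iff_dvd_diff dvd_diff_commute)
  then obtain t where t: "b - a = int l * t" ..
  have "\<exists>j. b - a = int (l * j)"
  proof (cases "t \<ge> 0")
    case True
    then show ?thesis
      using t by (intro exI[of _ "nat t"]) simp
  \<comment> \<open>As \<open>a \<le> b\<close>, a negative \<open>t\<close> is possible only for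
    \<open>l = 0\<close>, and then \<open>a = b\<close>.\<close>
  next
    case False
    then have "int l * t \<le> 0"
      by (simp add: mult_nonneg_nonpos)
    then have "b - a = 0"
      using t \<open>a \<le> b\<close> by linarith
    then show ?thesis
      by (intro exI[of _ 0]) simp
  qed
  then obtain j where j: "b = a + int (l * j)"
    by (metis add.commute diff_add_cancel)
  have "[unit_power n g b = unit_power n g a * (g ^ l) ^ j] (mod d)"
    using cong_dvd_modulus[OF unit_power_add_of_nat[OF n g, of a "l * j"] d]
    by (simp add: j power_mult)
  also have "[unit_power n g a * (g ^ l) ^ j = unit_power n g a * 1 ^ j] (mod d)"
    by (intro cong_mult cong_refl cong_pow l)
  finally show ?case
    by (simp add: cong_sym)
next
  case (sym a b)
  then show ?case
    by (simp add: cong_sym)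
qed

section \<open>Fixed points of contractions\<close>

text \<open>The contraction property in abstract form. The bound \<open>k < e\<close> keeps all
  conclusions modulo divisors of \<open>p ^ e\<close>, the precision to which the power map is
  known.\<close>

definition lifting :: "int \<Rightarrow> int \<Rightarrow> nat \<Rightarrow> (int \<Rightarrow> int) \<Rightarrow> bool" where
  "lifting m p e f \<longleftrightarrow>
    (\<forall>k<e. \<forall>a b. [a = b] (mod m * p ^ k) \<longrightarrow> [f a = f b] (mod p ^ Suc k))"

text \<open>Agreement of two fixed points modulo \<open>m * p ^ k\<close> passes to their images
  modulo \<open>p ^ Suc k\<close>, hence back to the points themselves.\<close>

lemma lifting_fixed_point_unique:
  fixes m p :: int
  assumes f: "lifting m p e f" and mp: "coprime m p"
    and x: "[f x = x] (mod p ^ e)" and y: "[f y = y] (mod p ^ e)" and xy: "[x = y] (mod m)"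
  shows "[x = y] (mod m * p ^ e)"
proof -
  have "[x = y] (mod m * p ^ k)" if "k \<le> e" for k
    using that
  proof (induction k)
    case 0
    then show ?case using xy by simp
  next
    case (Suc k)
    have dvd: "p ^ Suc k dvd p ^ e"
      using Suc.prems by (rule le_imp_power_dvd)
    have "[x = f x] (mod p ^ Suc k)"
      using cong_dvd_modulus[OF x dvd] by (rule cong_sym)
    also have "[f x = f y] (mod p ^ Suc k)"
      using f Suc unfolding lifting_def by simp
    also have "[f y = y] (mod p ^ Suc k)"
      using cong_dvd_modulus[OF y dvd] .
    finally show ?case
      using xy mp by (intro coprime_cong_mult) simp_all
  qed
  then show ?thesis
    by simp
qed

lemma lifting_fixed_point_exists:
  fixes m p :: int
  assumes f: "lifting m p e f" and mp: "coprime m p"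
  shows "\<exists>x. [x = r] (mod m) \<and> [f x = x] (mod p ^ e)"
proof -
  have "\<exists>x. [x = r] (mod m) \<and> [f x = x] (mod p ^ k)" if "k \<le> e" for k
    using that
  proof (induction k)
    case 0
    show ?case by (intro exI[of _ r]) simp
  next
    case (Suc k)
    then obtain x where x: "[x = r] (mod m)" "[f x = x] (mod p ^ k)"
      by auto
    have "coprime m (p ^ Suc k)"
      using mp by simp
    \<comment> \<open>\<open>f x\<close> itself may leave the class of \<open>r\<close>;
      \<open>y\<close> is the iterate corrected modulo \<open>m\<close>.\<close>
    then obtain y where y: "[y = r] (mod m)" "[y = f x] (mod p ^ Suc k)"
      using binary_chinese_remainder_int by blast
    have "[y = f x] (mod p ^ k)"
      using y(2) by (rule cong_dvd_modulus) simp
    then have "[y = x] (mod p ^ k)"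
      using x(2) by (rule cong_trans)
    moreover have "[y = x] (mod m)"
      using y(1) x(1) by (metis cong_sym cong_trans)
    ultimately have "[y = x] (mod m * p ^ k)"
      using mp by (intro coprime_cong_mult) simp_all
    then have "[f y = f x] (mod p ^ Suc k)"
      using f Suc.prems unfolding lifting_def by simp
    then have "[f y = y] (mod p ^ Suc k)"
      using y(2) by (metis cong_sym cong_trans)
    with y(1) show ?case by blast
  qed
  then show ?thesis
    by simp
qed

lemma cong_imp_eq_interval:
  fixes N x y :: int
  assumes "[x = y] (mod N)" "x \<in> {1..N}" "y \<in> {1..N}"
  shows "x = y"
proof -
  \<comment> \<open>The shift moves the interval to \<open>{0..N - 1}\<close>, where
    \<open>mod N\<close> is the identity.\<close>
  have "[x - 1 = y - 1] (mod N)"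
    using assms(1) by (simp add: cong_iff_dvd_diff)
  then show ?thesis
    using assms(2,3) by (simp add: cong_def)
qed

lemma ex_cong_interval:
  fixes N x :: int
  assumes "N > 0"
  shows "\<exists>y\<in>{1..N}. [y = x] (mod N)"
proof
  show "(x - 1) mod N + 1 \<in> {1..N}"
    using assms by (simp add: add1_zle_eq)
  show "[(x - 1) mod N + 1 = x] (mod N)"
    by (simp add: cong_def mod_simps)
qed

text \<open>The bijection yields both the count and the distinctness modulo
  \<open>m\<close>.\<close>

lemma lifting_fixed_points:
  fixes m p :: int
  assumes f: "lifting m p e f" and mp: "coprime m p" and pos: "m > 0" "p > 0" "e > 0"
    and S: "S = {x \<in> {1..p ^ e * m}. [f x = x] (mod p ^ e)}"
  shows "bij_betw (\<lambda>x. x mod m) S {0..<m}"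
  unfolding bij_betw_def
proof (intro conjI equalityI subsetI)
  show "inj_on (\<lambda>x. x mod m) S"
  proof (rule inj_onI)
    fix x y
    assume *: "x \<in> S" "y \<in> S" "x mod m = y mod m"
    then have "[x = y] (mod m * p ^ e)"
      by (intro lifting_fixed_point_unique[OF f mp]) (auto simp: S cong_def)
    then show "x = y"
      using * by (intro cong_imp_eq_interval[of x y "p ^ e * m"]) (auto simp: S mult.commute)
  qed
next
  fix r
  assume "r \<in> (\<lambda>x. x mod m) ` S"
  then show "r \<in> {0..<m}"
    using pos by auto
next
  fix r
  assume r: "r \<in> {0..<m}"
  obtain x where x: "[x = r] (mod m)" "[f x = x] (mod p ^ e)"
    using lifting_fixed_point_exists[OF f mp] by blast
  obtain y where y: "y \<in> {1..p ^ e * m}" "[y = x] (mod p ^ e * m)"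
    using ex_cong_interval[of "p ^ e * m" x] pos by auto
  have ym: "[y = x] (mod m)"
    using y(2) by (rule cong_dvd_modulus) simp
  have yp: "[y = x] (mod p ^ e)"
    using y(2) by (rule cong_modulus_mult)
  \<comment> \<open>The contraction at its last level, \<open>k = e - 1\<close>, shows that the
    representative \<open>y\<close> of \<open>x\<close> is again a fixed point.\<close>
  obtain k where k: "e = Suc k"
    using pos by (cases e) auto
  have "[y = x] (mod m * p ^ k)"
    using y(2) by (rule cong_dvd_modulus) (simp add: k)
  then have "[f y = f x] (mod p ^ e)"
    using f unfolding lifting_def k by simp
  then have "[f y = y] (mod p ^ e)"
    using x(2) yp by (metis cong_sym cong_trans)
  then have "y \<in> S"
    using y(1) by (simp add: S)
  moreover have "y mod m = r"
    using cong_trans[OF ym x(1)] r by (simp add: cong_def)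
  ultimately show "r \<in> (\<lambda>x. x mod m) ` S"
    by blast
qed

theorem corollary20:
  fixes p e m :: nat and c g :: int and S :: "int set"
  assumes "prime p" and "odd p" and "e \<ge> 1" and "\<not> int p dvd g"
    and "m = Pocklington.ord (int p) g"
    and "S = {x \<in> {1..int (p ^ e * m)}. [unit_power (int (p ^ e)) g (x - 1 + c) = x] (mod int (p ^ e))}"
  shows "card S = m
    \<and> (\<forall>x\<in>S. \<forall>y\<in>S. [x = y] (mod int m) \<longrightarrow> x = y)
    \<and> (\<forall>x\<in>S. coprime x (int p))"
proof -
  let ?n = "int p ^ e"
  define f where "f x = unit_power ?n g (x - 1 + c)" for x
  have p1: "p > 1"
    using \<open>prime p\<close> by (rule prime_gt_1_nat)
  have n: "?n > 1"
    using p1 \<open>e \<ge> 1\<close> by simp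
  have gp: "coprime g (int p)"
    using \<open>prime p\<close> \<open>\<not> int p dvd g\<close>
    by (metis prime_imp_coprime coprime_commute prime_nat_int_transfer)
  then have gn: "coprime g ?n"
    by simp
  define h where "h = nat (g mod int p)"
  have h: "int h = g mod int p"
    using p1 by (simp add: h_def)
  have m: "m = Pocklington.ord p h"
    using ord_int_eq_ord_nat[of p g] p1 assms(5) by (simp add: h_def)
  have "coprime (int p) (int h)"
    using gp p1 by (simp add: h coprime_commute del: coprime_int_iff)
  then have ph: "coprime p h"
    by simp
  then have "m > 0"
    by (simp add: m)
  have "[int (h ^ m) = int 1] (mod int p)"
    using ord[of h p] unfolding cong_int_iff m .
  then have gm: "[g ^ m = 1] (mod int p)"
    by (simp add: h cong_def power_mod)
  \<comment> \<open>A divisor of \<open>p - 1\<close> is coprime to \<open>p\<close>, as the Chinese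
    remainder step requires.\<close>
  have "m dvd p - 1"
    using order_divides_totient[OF ph] \<open>prime p\<close> by (simp add: m totient_prime)
  then have "coprime m p"
    using p1 coprime_diff_one_left_nat[of p] by (auto intro: coprime_divisors)
  then have mp: "coprime (int m) (int p)"
    by simp
  have lift: "lifting (int m) (int p) e f"
    unfolding lifting_def f_def
  proof (intro allI impI)
    fix k a b
    assume "k < e" and ab: "[a = b] (mod int m * int p ^ k)"
    then have "int p ^ Suc k dvd ?n"
      by (intro le_imp_power_dvd) simp
    moreover have "[a - 1 + c = b - 1 + c] (mod int (m * p ^ k))"
      using ab by (simp add: cong_iff_dvd_diff)
    ultimately show "[unit_power ?n g (a - 1 + c) = unit_power ?n g (b - 1 + c)] (mod int p ^ Suc k)"
      by (rule unit_power_cong[OF n gn _ cong_1_power_mult_prime_power[OF gm]])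
  qed
  have S: "S = {x \<in> {1..int p ^ e * int m}. [f x = x] (mod int p ^ e)}"
    using assms(6) by (simp add: f_def)
  have bij: "bij_betw (\<lambda>x. x mod int m) S {0..<int m}"
    using lifting_fixed_points[OF lift mp _ _ _ S] \<open>m > 0\<close> p1 \<open>e \<ge> 1\<close> by simp
  show ?thesis
  proof (intro conjI ballI impI)
    show "card S = m"
      using bij_betw_same_card[OF bij] by simp
  next
    fix x y
    assume "x \<in> S" "y \<in> S" "[x = y] (mod int m)"
    then show "x = y"
      using bij by (auto simp: bij_betw_def cong_def dest: inj_onD)
  next
    fix x
    assume "x \<in> S"
    then have "[f x = x] (mod ?n)"
      by (simp add: S)
    then have "coprime x ?n"
      using coprime_unit_power[OF n gn] unfolding f_def by (rule cong_imp_coprime)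
    then show "coprime x (int p)"
      using \<open>e \<ge> 1\<close> by simp
  qed
qed

end
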